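(* Let $r\ge 1$ and let $a_1,\dots,a_r$ be nonzero complex numbers. For every integer $n\ge 0$, \begin{align*} D_n(x|a_1,\dots,a_r)&=\sum_{m=0}^n S_1(n,m)B_m(x|a_1,\dots,a_r) =\sum_{j=0}^n\left(\sum_{l=j}^n\binom{n}{l}S_1(l,j)D_{n-l}(a_1,\dots,a_r)\right)x^j\\ &=\sum_{m=0}^n\binom{n}{m}D_{n-m}(a_1,\dots,a_r)(x)_m, \end{align*} and \begin{align*} \widehat D_n(x|a_1,\dots,a_r)&=\sum_{m=0}^n S_1(n,m)B_m(x+a_1+\cdots+a_r|a_1,\dots,a_r) =\sum_{j=0}^n\left(\sum_{l=j}^n\binom{n}{l}S_1(l,j)\widehat D_{n-l}(a_1,\dots,a_r)\right)x^j\\ &=\sum_{m=0}^n\binom{n}{m}\widehat D_{n-m}(a_1,\dots,a_r)(x)_m. \end{align*}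
   Context: For nonzero complex $a_1,\dots,a_r$, the Barnes-type Daehee polynomials of the first and second kind are defined by the formal power series identities $\prod_{j=1}^r\frac{\ln(1+t)}{(1+t)^{a_j}-1}(1+t)^x=\sum_{n\ge0}D_n(x|a_1,\dots,a_r)\frac{t^n}{n!}$ and $\prod_{j=1}^r\frac{(1+t)^{a_j}\ln(1+t)}{(1+t)^{a_j}-1}(1+t)^x=\sum_{n\ge0}\widehat D_n(x|a_1,\dots,a_r)\frac{t^n}{n!}$. The Barnes-type Daehee numbers are $D_n(a_1,\dots,a_r)=D_n(0|a_1,\dots,a_r)$ and $\widehat D_n(a_1,\dots,a_r)=\widehat D_n(0|a_1,\dots,a_r)$. Barnes' multiple Bernoulli polynomials are defined by $\frac{t^r}{\prod_{j=1}^r(e^{a_jt}-1)}e^{xt}=\sum_{n\ge0}B_n(x|a_1,\dots,a_r)\frac{t^n}{n!}$. $(x)_n=x(x-1)\cdots(x-n+1)$ for $n\ge1$, $(x)_0=1$, and the signed Stirling numbers of the first kind $S_1(n,m)$ are defined by $(x)_n=\sum_{m=0}^nS_1(n,m)x^m$. *)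

theory Defs
  imports Complex_Main "HOL-Computational_Algebra.Computational_Algebra"
begin

unbundle fps_syntax

text \<open>
  All generating functions are formal power series in \<open>t\<close>, over the complex numbers, for a complex
  value of \<open>x\<close>. In the library, \<open>t\<close> is \<open>fps_X\<close>, the series of \<open>(1 + t)\<^sup>a\<close> is \<open>fps_binomial a\<close>, that of
  \<open>ln (1 + t)\<close> is \<open>fps_ln 1\<close> and that of \<open>e\<^sup>a\<^sup>t\<close> is \<open>fps_exp a\<close>. The parameters \<open>a\<^sub>1, \<dots>, a\<^sub>r\<close> are the
  values of \<open>a :: nat \<Rightarrow> complex\<close> on \<open>{1..r}\<close>.

  None of the denominators is invertible as a power series, and the division of \<^typ>\<open>complex fps\<close>
  is exact only if the denominator divides the numerator. This is the case here whenever
  \<open>a\<^sub>1, \<dots>, a\<^sub>r\<close> are nonzero; see the lemmas \<open>\<dots>_exact\<close> below.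
\<close>

definition daehee_gf :: "nat \<Rightarrow> (nat \<Rightarrow> complex) \<Rightarrow> complex \<Rightarrow> complex fps" where
  "daehee_gf r a x =
     (\<Prod>j = 1..r. fps_ln 1 / (fps_binomial (a j) - 1)) * fps_binomial x"

definition daehee_hat_gf :: "nat \<Rightarrow> (nat \<Rightarrow> complex) \<Rightarrow> complex \<Rightarrow> complex fps" where
  "daehee_hat_gf r a x =
     (\<Prod>j = 1..r. (fps_binomial (a j) * fps_ln 1) / (fps_binomial (a j) - 1)) * fps_binomial x"

definition barnes_gf :: "nat \<Rightarrow> (nat \<Rightarrow> complex) \<Rightarrow> complex \<Rightarrow> complex fps" where
  "barnes_gf r a x =
     (fps_X ^ r / (\<Prod>j = 1..r. (fps_exp (a j) - 1))) * fps_exp x"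

definition daehee_poly :: "nat \<Rightarrow> (nat \<Rightarrow> complex) \<Rightarrow> nat \<Rightarrow> complex \<Rightarrow> complex" where
  "daehee_poly r a n x = fact n * daehee_gf r a x $ n"

definition daehee_hat_poly :: "nat \<Rightarrow> (nat \<Rightarrow> complex) \<Rightarrow> nat \<Rightarrow> complex \<Rightarrow> complex" where
  "daehee_hat_poly r a n x = fact n * daehee_hat_gf r a x $ n"

definition barnes_bernoulli_poly :: "nat \<Rightarrow> (nat \<Rightarrow> complex) \<Rightarrow> nat \<Rightarrow> complex \<Rightarrow> complex" where
  "barnes_bernoulli_poly r a n x = fact n * barnes_gf r a x $ n"

definition daehee_num :: "nat \<Rightarrow> (nat \<Rightarrow> complex) \<Rightarrow> nat \<Rightarrow> complex" where
  "daehee_num r a n = daehee_poly r a n 0"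

definition daehee_hat_num :: "nat \<Rightarrow> (nat \<Rightarrow> complex) \<Rightarrow> nat \<Rightarrow> complex" where
  "daehee_hat_num r a n = daehee_hat_poly r a n 0"

definition falling :: "'a :: comm_ring_1 \<Rightarrow> nat \<Rightarrow> 'a" where
  "falling x n = (\<Prod>i<n. x - of_nat i)"

text \<open>
  The defining expansion of \<open>(x)\<^sub>n\<close> in powers of \<open>x\<close> is read off with \<open>x\<close> the indeterminate
  \<open>[:0, 1:]\<close>. The numbers are signed, unlike \<open>stirling\<close> of \<open>HOL-Combinatorics.Stirling\<close>.
\<close>

definition S1 :: "nat \<Rightarrow> nat \<Rightarrow> int" where
  "S1 n m = poly.coeff (falling [:0, 1:] n) m"

lemma daehee_poly_gf: "Abs_fps (\<lambda>n. daehee_poly r a n x / fact n) = daehee_gf r a x"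
  by (simp add: fps_eq_iff daehee_poly_def)

lemma daehee_hat_poly_gf: "Abs_fps (\<lambda>n. daehee_hat_poly r a n x / fact n) = daehee_hat_gf r a x"
  by (simp add: fps_eq_iff daehee_hat_poly_def)

lemma barnes_bernoulli_poly_gf:
  "Abs_fps (\<lambda>n. barnes_bernoulli_poly r a n x / fact n) = barnes_gf r a x"
  by (simp add: fps_eq_iff barnes_bernoulli_poly_def)

lemma subdegree_fps_binomial_minus_1:
  assumes "(c :: complex) \<noteq> 0"
  shows "subdegree (fps_binomial c - 1) = 1"
  by (rule subdegreeI) (use assms in auto)

lemma subdegree_fps_exp_minus_1:
  assumes "(c :: complex) \<noteq> 0"
  shows "subdegree (fps_exp c - 1) = 1"
  by (rule subdegreeI) (use assms in auto)

lemma fps_binomial_minus_1_dvd_fps_ln: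
  assumes "(c :: complex) \<noteq> 0"
  shows "fps_binomial c - 1 dvd fps_ln 1"
proof -
  have "subdegree (fps_ln (1 :: complex)) = 1"
    by (rule subdegreeI) (auto simp: fps_ln_nth)
  moreover have "fps_binomial c - 1 \<noteq> 0"
    using subdegree_fps_binomial_minus_1[OF assms] by auto
  moreover have "fps_ln (1 :: complex) \<noteq> 0"
    using calculation by auto
  ultimately show ?thesis
    using subdegree_fps_binomial_minus_1[OF assms] by (simp add: fps_dvd_iff)
qed

lemma daehee_gf_exact:
  assumes "\<And>j. j \<in> {1..r} \<Longrightarrow> a j \<noteq> 0"
  shows "daehee_gf r a x * (\<Prod>j = 1..r. (fps_binomial (a j) - 1)) = fps_ln 1 ^ r * fps_binomial x"
proof -
  have "(\<Prod>j = 1..r. fps_ln 1 / (fps_binomial (a j) - 1)) * (\<Prod>j = 1..r. (fps_binomial (a j) - 1))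
      = (\<Prod>j = 1..r. fps_ln 1)"
    unfolding prod.distrib[symmetric]
    by (intro prod.cong refl dvd_div_mult_self fps_binomial_minus_1_dvd_fps_ln assms)
  then show ?thesis
    by (simp add: daehee_gf_def mult_ac)
qed

lemma daehee_hat_gf_exact:
  assumes "\<And>j. j \<in> {1..r} \<Longrightarrow> a j \<noteq> 0"
  shows "daehee_hat_gf r a x * (\<Prod>j = 1..r. (fps_binomial (a j) - 1))
       = (\<Prod>j = 1..r. fps_binomial (a j) * fps_ln 1) * fps_binomial x"
proof -
  have "(\<Prod>j = 1..r. (fps_binomial (a j) * fps_ln 1) / (fps_binomial (a j) - 1))
        * (\<Prod>j = 1..r. (fps_binomial (a j) - 1))
      = (\<Prod>j = 1..r. fps_binomial (a j) * fps_ln 1)"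
    unfolding prod.distrib[symmetric, of "\<lambda>j. _ j / _ j"]
    by (intro prod.cong refl dvd_div_mult_self dvd_mult fps_binomial_minus_1_dvd_fps_ln assms)
  then show ?thesis
    by (simp add: daehee_hat_gf_def mult_ac)
qed

lemma barnes_gf_exact:
  assumes "\<And>j. j \<in> {1..r} \<Longrightarrow> a j \<noteq> 0"
  shows "barnes_gf r a x * (\<Prod>j = 1..r. (fps_exp (a j) - 1)) = fps_X ^ r * fps_exp x"
proof -
  have "fps_exp c - 1 dvd fps_X" if "c \<noteq> 0" for c :: complex
    using subdegree_fps_exp_minus_1[OF that] that by (simp add: fps_dvd_iff)
  then have "(\<Prod>j = 1..r. (fps_exp (a j) - 1)) dvd (\<Prod>j = 1..r. fps_X)"
    by (intro prod_dvd_prod) (use assms in auto)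
  then have "(\<Prod>j = 1..r. (fps_exp (a j) - 1)) dvd fps_X ^ r"
    by simp
  then have "fps_X ^ r / (\<Prod>j = 1..r. (fps_exp (a j) - 1)) * (\<Prod>j = 1..r. (fps_exp (a j) - 1)) = fps_X ^ r"
    by (rule dvd_div_mult_self)
  then show ?thesis
    by (simp add: barnes_gf_def mult_ac)
qed

lemma falling_eq_sum_S1: "falling (x :: complex) n = (\<Sum>m = 0..n. of_int (S1 n m) * x ^ m)"
proof -
  define h :: "int poly \<Rightarrow> complex poly" where "h = map_poly of_int"
  have coeff_h: "poly.coeff (h p) m = of_int (poly.coeff p m)" for p m
    by (simp add: h_def coeff_map_poly)
  have h_mult: "h (p * q) = h p * h q" for p q
    by (rule poly_eqI) (simp add: coeff_h coeff_mult)
  have h_linear: "h ([:0, 1:] - of_nat k) = [:- of_nat k, 1:]" for k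
    by (simp add: h_def map_poly_pCons of_nat_poly)
  have h_falling: "poly (h (falling [:0, 1:] k)) x = falling x k" for k
  proof (induction k)
    case (Suc k)
    have "h (falling [:0, 1:] (Suc k)) = h (falling [:0, 1:] k) * [:- of_nat k, 1:]"
      by (simp only: falling_def prod.lessThan_Suc h_mult h_linear)
    then have "poly (h (falling [:0, 1:] (Suc k))) x = falling x k * (x - of_nat k)"
      by (simp only: poly_mult Suc) simp
    then show ?case
      by (simp add: falling_def)
  qed (simp add: falling_def h_def)
  have deg: "degree (falling [:0, 1 :: int:] k) \<le> k" for k
  proof (induction k)
    case (Suc k)
    have "degree (falling [:0, 1 :: int:] (Suc k))
        \<le> degree (falling [:0, 1 :: int:] k) + degree ([:0, 1 :: int:] - of_nat k)"
      unfolding falling_def prod.lessThan_Suc by (rule degree_mult_le)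
    then show ?case
      using Suc by (simp add: of_nat_poly)
  qed (simp add: falling_def)
  have "degree (h (falling [:0, 1:] n)) \<le> n"
    using deg[of n] by (intro degree_le) (auto simp: coeff_h coeff_eq_0)
  then have "poly (h (falling [:0, 1:] n)) x = (\<Sum>m\<le>n. of_int (S1 n m) * x ^ m)"
    unfolding poly_altdef S1_def coeff_h[symmetric]
    by (intro sum.mono_neutral_left) (auto simp: coeff_eq_0)
  then show ?thesis
    by (simp add: h_falling atLeast0AtMost)
qed

end

(*
  Composition with ln (1 + t) turns e^(ct) into (1 + t)^c. Hence it turns the generating function of
  Barnes' multiple Bernoulli polynomials into that of the Daehee polynomials of the first kind, and
  the Stirling numbers enter through the expansion of the powers of ln (1 + t). The Daehee
  polynomials of the second kind are those of the first kind with x shifted by a_1 + ... + a_r.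
*)
theory Submission
  imports Defs
begin

lemma fps_binomial_nth_eq_falling: "fps_binomial (x :: complex) $ n = falling x n / fact n"
  by (simp add: gbinomial_prod_rev falling_def atLeast0LessThan)

text \<open>The composition f satisfies f' = c f / (1 + t), an equation that determines (1 + t)^c up
  to a constant factor; the constant term of f is 1.\<close>

lemma fps_exp_compose_fps_ln: "fps_exp c oo fps_ln 1 = fps_binomial (c :: complex)"
proof -
  let ?f = "fps_exp c oo fps_ln 1"
  have "fps_deriv ?f = fps_const c * ?f * inverse (1 + fps_X)"
    by (simp add: fps_compose_deriv fps_ln_deriv fps_compose_mult_distrib)
  also have "\<dots> = fps_const c * ?f / (1 + fps_X)"
    by (simp add: fps_divide_unit)
  finally have "?f = fps_const (?f $ 0) * fps_binomial c"
    by (simp only: fps_binomial_ODE_unique)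
  then show ?thesis
    by simp
qed

text \<open>
  Both sides are, up to factorials, the coefficient of \<open>x ^ m\<close> in the coefficient of \<open>t ^ n\<close> in
  \<open>(1 + t) powr x = exp (x * ln (1 + t))\<close>.
\<close>

lemma fps_ln_power_nth:
  assumes "m \<le> n"
  shows "(fps_ln (1 :: complex) ^ m) $ n = fact m * of_int (S1 n m) / fact n"
proof -
  have "(\<Sum>i\<le>n. ((fps_ln 1 ^ i) $ n / fact i) * x ^ i) = (\<Sum>i\<le>n. (of_int (S1 n i) / fact n) * x ^ i)"
    for x :: complex
  proof -
    have "(\<Sum>i\<le>n. ((fps_ln 1 ^ i) $ n / fact i) * x ^ i) = fps_binomial x $ n"
      unfolding fps_exp_compose_fps_ln[symmetric] fps_compose_nth
      by (simp add: atLeast0AtMost mult.commute)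
    also have "\<dots> = (\<Sum>i\<le>n. (of_int (S1 n i) / fact n) * x ^ i)"
      by (simp add: fps_binomial_nth_eq_falling falling_eq_sum_S1 sum_divide_distrib atLeast0AtMost
          del: fps_binomial_nth)
    finally show ?thesis .
  qed
  \<comment> \<open>Polynomials in \<open>x\<close> that agree at every complex \<open>x\<close>
    have equal coefficients.\<close>
  then have "(fps_ln (1 :: complex) ^ m) $ n / fact m = of_int (S1 n m) / fact n"
    using assms polyfun_eq_coeffs[of "\<lambda>i. (fps_ln 1 ^ i) $ n / fact i" n
      "\<lambda>i. complex_of_int (S1 n i) / fact n"] by blast
  then show ?thesis
    by (simp add: field_simps)
qed

lemma prod_fps_binomial: "finite A \<Longrightarrow> (\<Prod>j\<in>A. fps_binomial (f j)) = fps_binomial (\<Sum>j\<in>A. f j :: complex)"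
  by (induction A rule: finite_induct) (auto simp: fps_binomial_add_mult)

text \<open>The factors have constant term 0 and are not units, so identities of generating
  functions are proved by multiplying by this product and then cancelling it in the integral domain
  of power series.\<close>

lemma prod_fps_binomial_minus_1_nonzero:
  fixes a :: "nat \<Rightarrow> complex"
  assumes "\<And>j. j \<in> {1..r} \<Longrightarrow> a j \<noteq> 0"
  shows "(\<Prod>j = 1..r. (fps_binomial (a j) - 1)) \<noteq> 0"
proof -
  have "fps_binomial c - 1 \<noteq> 0" if "c \<noteq> 0" for c :: complex
    using subdegree_fps_binomial_minus_1[OF that] by auto
  with assms show ?thesis
    by (simp add: prod_zero_iff)
qed

text \<open>Since ln (1 + t) has constant term 0, composing with it respects sums and products. It
  therefore carries the exact equation for \<open>barnes_gf\<close> to the one for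
  \<open>daehee_gf\<close>.\<close>

lemma daehee_gf_eq_barnes_gf_compose:
  assumes "\<And>j. j \<in> {1..r} \<Longrightarrow> a j \<noteq> 0"
  shows "daehee_gf r a x = barnes_gf r a x oo fps_ln 1"
proof -
  let ?P = "\<Prod>j = 1..r. (fps_binomial (a j) - 1)"
  have nonzero: "?P \<noteq> 0"
    by (intro prod_fps_binomial_minus_1_nonzero assms)
  have "(barnes_gf r a x oo fps_ln 1) * ?P
      = (barnes_gf r a x * (\<Prod>j = 1..r. (fps_exp (a j) - 1))) oo fps_ln 1"
    by (simp add: fps_compose_mult_distrib fps_compose_prod_distrib fps_compose_sub_distrib
        fps_exp_compose_fps_ln del: One_nat_def)
  also have "barnes_gf r a x * (\<Prod>j = 1..r. (fps_exp (a j) - 1)) = fps_X ^ r * fps_exp x"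
    by (intro barnes_gf_exact assms)
  also have "\<dots> oo fps_ln 1 = fps_ln 1 ^ r * fps_binomial x"
    by (simp add: fps_compose_mult_distrib fps_compose_power[symmetric] fps_exp_compose_fps_ln)
  also have "\<dots> = daehee_gf r a x * ?P"
    by (intro daehee_gf_exact[symmetric] assms)
  finally show ?thesis
    using mult_right_cancel[OF nonzero] by simp
qed

text \<open>The additional factors (1 + t)^(a_j) in the numerator combine with (1 + t)^x by adding
  exponents.\<close>

lemma daehee_hat_gf_eq_daehee_gf:
  assumes "\<And>j. j \<in> {1..r} \<Longrightarrow> a j \<noteq> 0"
  shows "daehee_hat_gf r a x = daehee_gf r a (x + (\<Sum>i = 1..r. a i))"
proof -
  let ?P = "\<Prod>j = 1..r. (fps_binomial (a j) - 1)"
  have nonzero: "?P \<noteq> 0"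
    by (intro prod_fps_binomial_minus_1_nonzero assms)
  have "daehee_hat_gf r a x * ?P = (\<Prod>j = 1..r. fps_binomial (a j) * fps_ln 1) * fps_binomial x"
    by (intro daehee_hat_gf_exact assms)
  also have "\<dots> = fps_ln 1 ^ r * fps_binomial (x + (\<Sum>i = 1..r. a i))"
    by (simp add: prod.distrib prod_fps_binomial fps_binomial_add_mult mult_ac)
  also have "\<dots> = daehee_gf r a (x + (\<Sum>i = 1..r. a i)) * ?P"
    by (intro daehee_gf_exact[symmetric] assms)
  finally show ?thesis
    using mult_right_cancel[OF nonzero] by simp
qed

lemma daehee_poly_eq_sum_barnes:
  assumes "\<And>j. j \<in> {1..r} \<Longrightarrow> a j \<noteq> 0"
  shows "daehee_poly r a n x = (\<Sum>m = 0..n. of_int (S1 n m) * barnes_bernoulli_poly r a m x)"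
proof -
  have "daehee_poly r a n x = fact n * (barnes_gf r a x oo fps_ln 1) $ n"
    unfolding daehee_poly_def
    by (intro arg_cong[where f = "\<lambda>F. fact n * F $ n"] daehee_gf_eq_barnes_gf_compose assms)
  also have "\<dots> = (\<Sum>m = 0..n. of_int (S1 n m) * barnes_bernoulli_poly r a m x)"
    \<comment> \<open>The \<open>fact m\<close> in \<open>barnes_bernoulli_poly\<close> is the one
      that \<open>fps_ln_power_nth\<close> produces, and \<open>fact n\<close> cancels.\<close>
    unfolding fps_compose_nth sum_distrib_left barnes_bernoulli_poly_def
    by (intro sum.cong) (simp_all add: fps_ln_power_nth)
  finally show ?thesis .
qed

text \<open>This is the binomial convolution of exponential generating functions: (1 + t)^x is that
  of the falling factorials of \<open>x\<close>.\<close>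

lemma fact_mult_fps_binomial_nth:
  fixes F :: "complex fps"
  shows "fact n * (F * fps_binomial x) $ n
    = (\<Sum>m = 0..n. of_nat (n choose m) * (fact (n - m) * F $ (n - m)) * falling x m)"
  unfolding mult.commute[of F] fps_mult_nth sum_distrib_left
  by (intro sum.cong)
    (simp_all add: fps_binomial_nth_eq_falling binomial_fact field_simps del: fps_binomial_nth)

text \<open>Expand the falling factorials by \<open>S1\<close> and exchange the sums over the
  triangle j \<le> l \<le> n.\<close>

lemma sum_falling_eq_sum_powers:
  fixes c :: "nat \<Rightarrow> complex"
  shows "(\<Sum>m = 0..n. of_nat (n choose m) * c (n - m) * falling x m)
    = (\<Sum>j = 0..n. (\<Sum>l = j..n. of_nat (n choose l) * of_int (S1 l j) * c (n - l)) * x ^ j)"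
proof -
  have "(\<Sum>m = 0..n. of_nat (n choose m) * c (n - m) * falling x m)
      = (\<Sum>l = 0..n. \<Sum>j = 0..l. of_nat (n choose l) * of_int (S1 l j) * c (n - l) * x ^ j)"
    by (simp add: falling_eq_sum_S1 sum_distrib_left mult_ac)
  also have "\<dots> = (\<Sum>j = 0..n. \<Sum>l = j..n. of_nat (n choose l) * of_int (S1 l j) * c (n - l) * x ^ j)"
    unfolding sum.Sigma[OF finite_atLeastAtMost ballI[OF finite_atLeastAtMost]]
    by (rule sum.reindex_bij_witness[of _ prod.swap prod.swap]) auto
  finally show ?thesis
    by (simp add: sum_distrib_right)
qed

text \<open>The variable \<open>x\<close> enters \<open>daehee_gf\<close> only through the factor (1
  + t)^x, so the rest is the generating function at 0.\<close>

lemma daehee_poly_eq_sum_falling: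
  "daehee_poly r a n x = (\<Sum>m = 0..n. of_nat (n choose m) * daehee_num r a (n - m) * falling x m)"
  using fact_mult_fps_binomial_nth[of n "daehee_gf r a 0" x]
  by (simp add: daehee_num_def daehee_poly_def daehee_gf_def)

lemma daehee_hat_poly_eq_sum_falling:
  "daehee_hat_poly r a n x
    = (\<Sum>m = 0..n. of_nat (n choose m) * daehee_hat_num r a (n - m) * falling x m)"
  using fact_mult_fps_binomial_nth[of n "daehee_hat_gf r a 0" x]
  by (simp add: daehee_hat_num_def daehee_hat_poly_def daehee_hat_gf_def)

theorem theorem1:
  fixes r n :: nat and a :: "nat \<Rightarrow> complex" and x :: complex
  assumes "r \<ge> 1" and "\<And>j. j \<in> {1..r} \<Longrightarrow> a j \<noteq> 0"
  shows
    "daehee_poly r a n x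
       = (\<Sum>m = 0..n. of_int (S1 n m) * barnes_bernoulli_poly r a m x) \<and>
     daehee_poly r a n x
       = (\<Sum>j = 0..n. (\<Sum>l = j..n. of_nat (n choose l) * of_int (S1 l j) * daehee_num r a (n - l)) * x ^ j) \<and>
     daehee_poly r a n x
       = (\<Sum>m = 0..n. of_nat (n choose m) * daehee_num r a (n - m) * falling x m) \<and>
     daehee_hat_poly r a n x
       = (\<Sum>m = 0..n. of_int (S1 n m) * barnes_bernoulli_poly r a m (x + (\<Sum>i = 1..r. a i))) \<and>
     daehee_hat_poly r a n x
       = (\<Sum>j = 0..n. (\<Sum>l = j..n. of_nat (n choose l) * of_int (S1 l j) * daehee_hat_num r a (n - l)) * x ^ j) \<and>
     daehee_hat_poly r a n x
       = (\<Sum>m = 0..n. of_nat (n choose m) * daehee_hat_num r a (n - m) * falling x m)"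
proof -
  have "daehee_hat_poly r a n x = daehee_poly r a n (x + (\<Sum>i = 1..r. a i))"
    unfolding daehee_hat_poly_def daehee_poly_def
    by (intro arg_cong[where f = "\<lambda>F. fact n * F $ n"] daehee_hat_gf_eq_daehee_gf assms)
  moreover have "daehee_poly r a n y
      = (\<Sum>m = 0..n. of_int (S1 n m) * barnes_bernoulli_poly r a m y)" for y
    by (intro daehee_poly_eq_sum_barnes assms)
  ultimately show ?thesis
    \<comment> \<open>This turns the expansions in powers of \<open>x\<close> into those in falling
      factorials.\<close>
    unfolding sum_falling_eq_sum_powers[symmetric]
    using daehee_poly_eq_sum_falling[of r a n x] daehee_hat_poly_eq_sum_falling[of r a n x]
    by metis
qed

end
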